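(* Let $C$ be any subdivision of a convex $d$-polytope. Then the derived subdivision $\operatorname{sd}C$ is collapsible.
   Context: A subdivision of a convex polytope $P$ is a (geometric) polytopal complex $C$ with $|C|=P$. A derived subdivision $\operatorname{sd}C$ is obtained by stellar subdivisions at all faces in order of decreasing dimension (inserting a vertex in the relative interior of each face and coning). A complex is collapsible if it can be reduced to a single vertex by a sequence of elementary collapses, each deleting a free face (a nonempty face strictly contained in exactly one other face). *)

theory Defs
  imports "HOL-Analysis.Analysis"
begin

definition polytopal_complex :: "'a::euclidean_space set set \<Rightarrow> bool" where
  "polytopal_complex C \<longleftrightarrow> finite C \<and>
     (\<forall>P\<in>C. polytope P \<and> P \<noteq> {}) \<and>
     (\<forall>P\<in>C. \<forall>F. F face_of P \<and> F \<noteq> {} \<longrightarrow> F \<in> C) \<and>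
     (\<forall>P\<in>C. \<forall>Q\<in>C. (P \<inter> Q) face_of P \<and> (P \<inter> Q) face_of Q)"

definition subdivision_of :: "'a::euclidean_space set set \<Rightarrow> 'a set \<Rightarrow> bool" where
  "subdivision_of C P \<longleftrightarrow> polytopal_complex C \<and> \<Union>C = P"

text \<open>Stellar subdivision of the complex K at the face s with new vertex v (v is meant to lie
 in the relative interior of s): remove the open star of s (all faces containing s) and
 add the cones from v over all faces of the closed star that do not contain s, and v itself.\<close>
definition stellar :: "'a::euclidean_space set set \<Rightarrow> 'a set \<Rightarrow> 'a \<Rightarrow> 'a set set" where
  "stellar K s v =
     (K - {t\<in>K. s \<subseteq> t}) \<union>
     {convex hull (insert v r) | r. r \<in> K \<and> \<not> s \<subseteq> r \<and> (\<exists>t\<in>K. s \<subseteq> t \<and> r \<subseteq> t)} \<union>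
     {{v}}"

definition derived_subdivision :: "'a::euclidean_space set set \<Rightarrow> 'a set set \<Rightarrow> bool" where
  "derived_subdivision C D \<longleftrightarrow>
     (\<exists>fs p. distinct fs \<and> set fs = C \<and>
        sorted_wrt (\<lambda>s t. aff_dim s \<ge> aff_dim t) fs \<and>
        (\<forall>s\<in>C. p s \<in> rel_interior s) \<and>
        D = fold (\<lambda>s K. stellar K s (p s)) fs C)"

definition elementary_collapse :: "'a set set \<Rightarrow> 'a set set \<Rightarrow> bool" where
  "elementary_collapse K K' \<longleftrightarrow>
     (\<exists>s t. s \<in> K \<and> t \<in> K \<and> s \<noteq> {} \<and> s \<subset> t \<and> (\<forall>r\<in>K. s \<subset> r \<longrightarrow> r = t) \<and>
        K' = K - {s, t})"

definition collapsible :: "'a set set \<Rightarrow> bool" where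
  "collapsible K \<longleftrightarrow> (\<exists>v. elementary_collapse\<^sup>*\<^sup>* K {{v}})"

end

theory Submission
  imports Defs
begin

text \<open>The complex \<open>sd C\<close> is the order complex of the face poset of \<open>C\<close>, so it suffices to show that
  the order complex of a finite complex of (possibly unbounded) polyhedra with convex union is
  collapsible. Fix a point \<open>x0\<close> of the union and remove the cells from the poset in the order of
  decreasing distance from \<open>x0\<close>; removing a cell is a sequence of collapses when the order complex
  of the remaining cells comparable to it is collapsible. Let \<open>x\<close> be the point of the cell closest
  to \<open>x0\<close>. If it lies on the relative boundary, that order complex is a cone over the smallest cell
  through \<open>x\<close>. Otherwise the comparable cells are those which contain \<open>x\<close> and come closer to \<open>x0\<close>;
  they correspond to the slices of their tangent cones at \<open>x\<close> by a hyperplane orthogonal to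
  \<open>x0 - x\<close>. These slices again form a complex of polyhedra with convex union, of smaller
  dimension.\<close>

section \<open>Collapses of order complexes\<close>

definition order_complex :: "'a set set \<Rightarrow> 'a set set set" where
  "order_complex Q = {c. c \<subseteq> Q \<and> c \<noteq> {} \<and> chain_subset c}"

text \<open>Omitting the empty face makes this a complex to which \<open>collapsible\<close>
  applies; the face \<open>{x}\<close> of \<open>K\<close> then has no counterpart here.\<close>

definition link :: "'a \<Rightarrow> 'a set set \<Rightarrow> 'a set set" where
  "link x K = {s. x \<notin> s \<and> s \<noteq> {} \<and> insert x s \<in> K}"

lemma elementary_collapseI:
  assumes "s \<in> K" "t \<in> K" "s \<noteq> {}" "s \<subset> t" "\<And>r. r \<in> K \<Longrightarrow> s \<subset> r \<Longrightarrow> r = t" "K' = K - {s, t}"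
  shows "elementary_collapse K K'"
  unfolding elementary_collapse_def using assms by (intro exI[of _ s] exI[of _ t] conjI ballI impI)

lemma elementary_collapse_image:
  assumes ec: "elementary_collapse K K'" and inj: "inj_on g K"
    and emb: "\<And>s t. s \<in> K \<Longrightarrow> t \<in> K \<Longrightarrow> g s \<subset> g t \<longleftrightarrow> s \<subset> t"
    and ne: "\<And>s. s \<in> K \<Longrightarrow> g s \<noteq> {}"
  shows "elementary_collapse (g ` K) (g ` K')"
proof -
  obtain s t where st: "s \<in> K" "t \<in> K" "s \<subset> t" "\<forall>r\<in>K. s \<subset> r \<longrightarrow> r = t" "K' = K - {s, t}"
    using ec unfolding elementary_collapse_def by blast
  show ?thesis
  proof (rule elementary_collapseI)
    show "g s \<in> g ` K" "g t \<in> g ` K" using st(1,2) by simp_all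
    show "g s \<noteq> {}" using ne[OF st(1)] .
    show "g s \<subset> g t" using emb[OF st(1,2)] st(3) by simp
    show "r = g t" if r: "r \<in> g ` K" "g s \<subset> r" for r
    proof -
      obtain r' where r': "r' \<in> K" "r = g r'" using r(1) by blast
      then have "r' = t" using emb[OF st(1) r'(1)] st(4) r(2) by simp
      then show ?thesis using r'(2) by simp
    qed
    show "g ` K' = g ` K - {g s, g t}"
      using st(1,2) unfolding st(5) by (subst inj_on_image_set_diff[OF inj]) auto
  qed
qed

text \<open>Collapses see only the inclusion order of the faces. This serves twice: to carry chains
  back along an order embedding of cells, and to turn chains into convex hulls.\<close>

lemma collapses_image:
  assumes "elementary_collapse\<^sup>*\<^sup>* K K'" and "inj_on g K"
    and "\<And>s t. s \<in> K \<Longrightarrow> t \<in> K \<Longrightarrow> g s \<subset> g t \<longleftrightarrow> s \<subset> t"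
    and "\<And>s. s \<in> K \<Longrightarrow> g s \<noteq> {}"
  shows "elementary_collapse\<^sup>*\<^sup>* (g ` K) (g ` K')"
  using assms
proof (induction rule: converse_rtranclp_induct)
  case base
  then show ?case by simp
next
  case (step K L)
  have "L \<subseteq> K"
    using step.hyps(1) unfolding elementary_collapse_def by blast
  then have "elementary_collapse\<^sup>*\<^sup>* (g ` L) (g ` K')"
    using step by (meson inj_on_subset subsetD)
  moreover have "elementary_collapse (g ` K) (g ` L)"
    using step.hyps(1) step.prems by (rule elementary_collapse_image)
  ultimately show ?case by (rule converse_rtranclp_into_rtranclp[rotated])
qed

text \<open>The faces through \<open>x\<close> other than \<open>{x}\<close> mirror the link, so
  each collapse of the link lifts to one of \<open>K\<close>. Once the link is a single vertex
  \<open>w\<close>, the face \<open>{x}\<close> is free in \<open>{x, w}\<close>, and this last pair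
  goes too.\<close>

lemma collapses_to_deletion:
  assumes "collapsible (link x K)" and x: "{x} \<in> K"
  shows "elementary_collapse\<^sup>*\<^sup>* K {s \<in> K. x \<notin> s}"
proof -
  obtain w where w: "elementary_collapse\<^sup>*\<^sup>* (link x K) {{w}}"
    using assms unfolding collapsible_def by blast
  define D where "D = {s \<in> K. x \<notin> s}"
  \<comment> \<open>\<open>E L\<close> is the intermediate complex in which the link of
    \<open>x\<close> has shrunk to \<open>L\<close>.\<close>
  define E where "E L = D \<union> {{x}} \<union> insert x ` L" for L
  have EK: "E (link x K) = K"
  proof
    show "E (link x K) \<subseteq> K" using x by (auto simp: E_def D_def link_def)
    show "K \<subseteq> E (link x K)"
    proof
      fix s assume s: "s \<in> K"
      consider "x \<notin> s" | "s = {x}" | "x \<in> s" "s - {x} \<noteq> {}" by blast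
      then show "s \<in> E (link x K)"
      proof cases
        case 3
        then have "s - {x} \<in> link x K" "s = insert x (s - {x})"
          using s by (auto simp: link_def insert_absorb)
        then show ?thesis unfolding E_def by blast
      qed (use s in \<open>auto simp: E_def D_def\<close>)
    qed
  qed
  have "elementary_collapse\<^sup>*\<^sup>* (E (link x K)) (E L) \<and> L \<subseteq> link x K"
    if "elementary_collapse\<^sup>*\<^sup>* (link x K) L" for L
    using that
  proof (induction rule: rtranclp_induct)
    case base
    then show ?case by simp
  next
    case (step L M)
    obtain s t where st: "s \<in> L" "t \<in> L" "s \<noteq> {}" "s \<subset> t" "\<forall>r\<in>L. s \<subset> r \<longrightarrow> r = t" "M = L - {s, t}"
      using step.hyps unfolding elementary_collapse_def by blast
    have L: "x \<notin> r \<and> r \<noteq> {}" if "r \<in> L" for r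
      using step.IH that by (auto simp: link_def)
    have inj: "inj_on (insert x) L"
      using L by (meson inj_onI insert_ident)
    have "insert x ` M = insert x ` L - {insert x s, insert x t}"
      using st(1,2) unfolding st(6) by (subst inj_on_image_set_diff[OF inj]) auto
    moreover have "{x} \<noteq> insert x s" "{x} \<noteq> insert x t" "insert x s \<notin> D" "insert x t \<notin> D"
      using L[OF st(1)] L[OF st(2)] unfolding D_def by blast+
    ultimately have eq: "E M = E L - {insert x s, insert x t}"
      unfolding E_def by blast
    have "\<forall>r\<in>E L. insert x s \<subset> r \<longrightarrow> r = insert x t"
    proof (intro ballI impI)
      fix r assume r: "r \<in> E L" "insert x s \<subset> r"
      then obtain r' where r': "r' \<in> L" "r = insert x r'"
        using L st(1) unfolding E_def D_def by blast
      then have "s \<subset> r'" using r(2) L[OF st(1)] L[OF r'(1)] by blast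
      then show "r = insert x t" using st(5) r' by blast
    qed
    moreover have "insert x s \<subset> insert x t" using L[OF st(1)] L[OF st(2)] st(4) by auto
    moreover have "insert x s \<in> E L" "insert x t \<in> E L"
      using st(1,2) unfolding E_def by blast+
    ultimately have "elementary_collapse (E L) (E M)"
      using eq by (intro elementary_collapseI[of "insert x s" _ "insert x t"]) blast+
    then show ?case using step.IH st(6) by auto
  qed
  from this[OF w] have 1: "elementary_collapse\<^sup>*\<^sup>* K (E {{w}})" and "w \<noteq> x"
    unfolding EK by (auto simp: link_def)
  have E: "E {{w}} = D \<union> {{x}} \<union> {{x, w}}"
    by (simp add: E_def)
  have D: "x \<notin> r" if "r \<in> D" for r
    using that by (simp add: D_def)
  have "D = E {{w}} - {{x}, {x, w}}" "\<forall>r\<in>E {{w}}. {x} \<subset> r \<longrightarrow> r = {x, w}"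
    unfolding E using D by blast+
  moreover have "{x} \<subset> {x, w}" "{x} \<in> E {{w}}" "{x, w} \<in> E {{w}}"
    using \<open>w \<noteq> x\<close> by (auto simp: E)
  ultimately have "elementary_collapse (E {{w}}) D" by (intro elementary_collapseI[of "{x}" _ "{x, w}"]) blast+
  with 1 show ?thesis unfolding D_def by simp
qed

section \<open>Removing cells from a poset\<close>

lemma link_order_complex:
  assumes x: "x \<in> Q"
  shows "link x (order_complex Q) = order_complex {y \<in> Q. y \<subset> x \<or> x \<subset> y}"
proof (intro set_eqI iffI)
  fix c assume "c \<in> link x (order_complex Q)"
  then have c: "x \<notin> c" "c \<noteq> {}" "c \<subseteq> Q" "chain_subset (insert x c)"
    by (simp_all add: link_def order_complex_def)
  have "y \<subset> x \<or> x \<subset> y" if "y \<in> c" for y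
    using c(1,4) that by (metis chain_subset_def insertI1 insertI2 psubsetI)
  moreover have "chain_subset c"
    using c(4) by (simp add: chain_subset_def)
  ultimately show "c \<in> order_complex {y \<in> Q. y \<subset> x \<or> x \<subset> y}"
    using c(2,3) by (simp add: order_complex_def subset_iff)
next
  fix c assume "c \<in> order_complex {y \<in> Q. y \<subset> x \<or> x \<subset> y}"
  then have c: "c \<noteq> {}" "chain_subset c" "\<And>y. y \<in> c \<Longrightarrow> y \<in> Q \<and> (y \<subset> x \<or> x \<subset> y)"
    by (auto simp only: order_complex_def)
  have "\<forall>y\<in>c. y \<subseteq> x \<or> x \<subseteq> y" using c(3) by (meson psubset_imp_subset)
  then have "chain_subset (insert x c)" using c(2) by (simp add: chain_subset_def disj_commute)
  moreover have "x \<notin> c" "insert x c \<subseteq> Q" using c(3) x by blast+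
  ultimately show "c \<in> link x (order_complex Q)"
    using c(1) by (simp add: link_def order_complex_def)
qed

text \<open>Deleting \<open>x\<close> from the poset deletes a vertex of the order complex, whose
  link consists of the chains of cells comparable to \<open>x\<close>. All removals of cells below
  go through this step.\<close>

lemma order_complex_remove:
  assumes "x \<in> Q" and "collapsible (order_complex {y \<in> Q. y \<subset> x \<or> x \<subset> y})"
    and "collapsible (order_complex (Q - {x}))"
  shows "collapsible (order_complex Q)"
proof -
  have "{x} \<in> order_complex Q"
    using assms(1) by (simp add: order_complex_def chain_subset_def)
  then have "elementary_collapse\<^sup>*\<^sup>* (order_complex Q) {s \<in> order_complex Q. x \<notin> s}"
    using assms link_order_complex by (metis collapses_to_deletion)
  moreover have "{s \<in> order_complex Q. x \<notin> s} = order_complex (Q - {x})"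
    by (auto simp: order_complex_def)
  ultimately show ?thesis
    using assms(3) unfolding collapsible_def by (metis rtranclp_trans)
qed

text \<open>Every cell other than \<open>m\<close> can be removed: \<open>m\<close> is present among
  the cells comparable to it and is comparable to all of them, so the induction covers both the link
  and the rest.\<close>

lemma collapsible_order_complex_cone:
  assumes "finite Q" and "m \<in> Q" and "\<And>y. y \<in> Q \<Longrightarrow> y \<subseteq> m \<or> m \<subseteq> y"
  shows "collapsible (order_complex Q)"
  using assms
proof (induction "card Q" arbitrary: Q rule: less_induct)
  case less
  show ?case
  proof (cases "Q = {m}")
    case True
    then have "order_complex Q = {{m}}"
      by (auto simp: order_complex_def chain_subset_def)
    then show ?thesis unfolding collapsible_def by auto
  next
    case False
    then obtain y where y: "y \<in> Q" "y \<noteq> m" using less.prems(2) by blast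
    have "collapsible (order_complex {z \<in> Q. z \<subset> y \<or> y \<subset> z})"
    proof (rule less.hyps)
      show "card {z \<in> Q. z \<subset> y \<or> y \<subset> z} < card Q"
        by (rule psubset_card_mono) (use less.prems y in auto)
    qed (use less.prems y in auto)
    moreover have "collapsible (order_complex (Q - {y}))"
      using less.prems y by (intro less.hyps card_Diff1_less) simp_all
    ultimately show ?thesis using order_complex_remove y(1) by blast
  qed
qed

text \<open>This lets cells be replaced by their slices. The collapses are given on the image, so
  they are carried back along the inverse of \<open>f\<close>.\<close>

lemma collapsible_order_complex_embedding:
  assumes "collapsible (order_complex (f ` Q))"
    and emb: "\<And>a b. a \<in> Q \<Longrightarrow> b \<in> Q \<Longrightarrow> f a \<subseteq> f b \<longleftrightarrow> a \<subseteq> b"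
  shows "collapsible (order_complex Q)"
proof -
  have inj: "inj_on f Q"
    using emb by (metis inj_onI set_eq_subset)
  define g where "g = inv_into Q f"
  have gf: "g (f a) = a" if "a \<in> Q" for a
    using inj that by (simp add: g_def)
  have gQ: "g ` f ` Q = Q"
    using gf by force
  have g_inj: "inj_on g (f ` Q)"
    using gf by (auto intro!: inj_onI)
  have g_emb: "g a \<subseteq> g b \<longleftrightarrow> a \<subseteq> b" if "a \<in> f ` Q" "b \<in> f ` Q" for a b
    using that gf emb by (metis imageE)
  have chain: "chain_subset (g ` c) \<longleftrightarrow> chain_subset c" if "c \<subseteq> f ` Q" for c
    using that g_emb by (auto simp: chain_subset_def) (meson subsetD)+
  have "(\<lambda>c. g ` c) ` order_complex (f ` Q) = order_complex Q"
  proof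
    show "(\<lambda>c. g ` c) ` order_complex (f ` Q) \<subseteq> order_complex Q"
      using gQ chain image_mono[of _ "f ` Q" g] by (simp add: order_complex_def image_subset_iff Ball_def) blast
    show "order_complex Q \<subseteq> (\<lambda>c. g ` c) ` order_complex (f ` Q)"
    proof
      fix c assume c: "c \<in> order_complex Q"
      then have c': "c \<subseteq> Q" "c \<noteq> {}" "chain_subset c"
        by (simp_all add: order_complex_def)
      then have fc: "f ` c \<subseteq> f ` Q" by blast
      have "g ` f ` c = (\<lambda>a. a) ` c"
        unfolding image_image using gf c'(1) by (intro image_cong) auto
      then have gfc: "c = g ` f ` c" by simp
      have "f ` c \<in> order_complex (f ` Q)"
        unfolding order_complex_def using chain[OF fc] gfc c' fc by simp
      then show "c \<in> (\<lambda>c. g ` c) ` order_complex (f ` Q)"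
        by (rule image_eqI[where f = "image g", OF gfc])
    qed
  qed
  moreover obtain v where "elementary_collapse\<^sup>*\<^sup>* (order_complex (f ` Q)) {{v}}"
    using assms(1) unfolding collapsible_def by blast
  then have "elementary_collapse\<^sup>*\<^sup>* ((\<lambda>c. g ` c) ` order_complex (f ` Q)) ((\<lambda>c. g ` c) ` {{v}})"
  proof (rule collapses_image)
    have sub: "c \<subseteq> f ` Q" if "c \<in> order_complex (f ` Q)" for c
      using that by (simp add: order_complex_def)
    show "inj_on ((`) g) (order_complex (f ` Q))"
      using inj_on_image_eq_iff[OF g_inj] sub by (auto intro!: inj_onI)
    show "g ` s \<subset> g ` t \<longleftrightarrow> s \<subset> t"
      if "s \<in> order_complex (f ` Q)" "t \<in> order_complex (f ` Q)" for s t
      using inj_on_image_subset_iff[OF g_inj] sub that by (simp add: psubset_eq inj_on_image_eq_iff[OF g_inj])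
    show "g ` s \<noteq> {}" if "s \<in> order_complex (f ` Q)" for s
      using that by (simp add: order_complex_def)
  qed
  ultimately show ?thesis unfolding collapsible_def by auto
qed

section \<open>Tangent cones\<close>

text \<open>The apex is \<open>x\<close> itself rather than the origin, so the cone contains
  \<open>S\<close> and can be cut by hyperplanes in place. For convex \<open>S\<close> through
  \<open>x\<close> it is the cone of feasible directions.\<close>

definition tangent_cone :: "'a::real_vector \<Rightarrow> 'a set \<Rightarrow> 'a set" where
  "tangent_cone x S = {y. \<exists>e>0. x + e *\<^sub>R (y - x) \<in> S}"

lemma segment_point_mono:
  assumes "convex S" "x \<in> S" "x + e *\<^sub>R (y - x) \<in> S" "0 \<le> d" "d \<le> e"
  shows "x + d *\<^sub>R (y - x) \<in> S"
proof (cases "e = 0")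
  case False
  have "(1 - d / e) *\<^sub>R x + (d / e) *\<^sub>R (x + e *\<^sub>R (y - x)) \<in> S"
    using assms False by (intro convexD) auto
  also have "(1 - d / e) *\<^sub>R x + (d / e) *\<^sub>R (x + e *\<^sub>R (y - x)) = x + d *\<^sub>R (y - x)"
    using False by (simp add: algebra_simps)
  finally show ?thesis .
qed (use assms in auto)

text \<open>By convexity every shorter step also stays in \<open>S\<close>, so several points or
  sets can share one step length.\<close>

lemma tangent_coneE:
  assumes "y \<in> tangent_cone x S" "convex S" "x \<in> S"
  obtains e where "e > 0" "\<And>d. 0 \<le> d \<Longrightarrow> d \<le> e \<Longrightarrow> x + d *\<^sub>R (y - x) \<in> S"
  using assms segment_point_mono unfolding tangent_cone_def by blast

lemma tangent_coneI:
  "e > 0 \<Longrightarrow> x + e *\<^sub>R (y - x) \<in> S \<Longrightarrow> y \<in> tangent_cone x S"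
  unfolding tangent_cone_def by blast

lemma tangent_cone_mono: "S \<subseteq> T \<Longrightarrow> tangent_cone x S \<subseteq> tangent_cone x T"
  unfolding tangent_cone_def by blast

lemma tangent_cone_Int:
  assumes "convex S" "convex T" "x \<in> S" "x \<in> T"
  shows "tangent_cone x (S \<inter> T) = tangent_cone x S \<inter> tangent_cone x T"
proof
  show "tangent_cone x (S \<inter> T) \<subseteq> tangent_cone x S \<inter> tangent_cone x T"
    by (simp add: tangent_cone_mono)
  show "tangent_cone x S \<inter> tangent_cone x T \<subseteq> tangent_cone x (S \<inter> T)"
  proof
    fix y assume y: "y \<in> tangent_cone x S \<inter> tangent_cone x T"
    obtain d where d: "d > 0" "\<And>a. 0 \<le> a \<Longrightarrow> a \<le> d \<Longrightarrow> x + a *\<^sub>R (y - x) \<in> S"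
      using y assms by (auto elim: tangent_coneE)
    obtain e where e: "e > 0" "\<And>a. 0 \<le> a \<Longrightarrow> a \<le> e \<Longrightarrow> x + a *\<^sub>R (y - x) \<in> T"
      using y assms by (auto elim: tangent_coneE)
    show "y \<in> tangent_cone x (S \<inter> T)"
      using d e by (intro tangent_coneI[of "min d e"]) auto
  qed
qed

lemma tangent_cone_Inter:
  assumes "finite F" "\<And>S. S \<in> F \<Longrightarrow> convex S \<and> x \<in> S"
  shows "tangent_cone x (\<Inter>F) = (\<Inter>S\<in>F. tangent_cone x S)"
  using assms
proof (induction F rule: finite_induct)
  case empty
  then show ?case by (auto intro: tangent_coneI[of 1])
next
  case (insert S F)
  then have "convex (\<Inter>F)" "x \<in> \<Inter>F"
    by (auto intro: convex_Inter)
  then show ?case using insert tangent_cone_Int[of S "\<Inter>F" x] by auto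
qed

lemma tangent_cone_halfspace:
  fixes a :: "'a::euclidean_space"
  assumes "a \<bullet> x \<le> b"
  shows "tangent_cone x {y. a \<bullet> y \<le> b} = (if a \<bullet> x = b then {y. a \<bullet> y \<le> b} else UNIV)"
proof (cases "a \<bullet> x = b")
  case True
  have "y \<in> tangent_cone x {y. a \<bullet> y \<le> b} \<longleftrightarrow> a \<bullet> y \<le> b" for y
    using True by (auto simp: tangent_cone_def inner_add_right inner_diff_right mult_le_0_iff intro: exI[of _ 1])
  then show ?thesis using True by auto
next
  case False
  have "y \<in> tangent_cone x {y. a \<bullet> y \<le> b}" for y
  proof -
    \<comment> \<open>The slack at \<open>x\<close> divided by a bound on the slope; the summand 1
      keeps the denominator positive.\<close>
    define e where "e = (b - a \<bullet> x) / (1 + \<bar>a \<bullet> (y - x)\<bar>)"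
    have "e > 0" using False assms by (simp add: e_def)
    have "e * (a \<bullet> (y - x)) \<le> e * (1 + \<bar>a \<bullet> (y - x)\<bar>)"
      using \<open>e > 0\<close> by (intro mult_left_mono) auto
    also have "\<dots> = b - a \<bullet> x" by (simp add: e_def)
    finally show ?thesis
      using \<open>e > 0\<close> by (intro tangent_coneI[of e]) (auto simp: inner_add_right)
  qed
  then show ?thesis using False by auto
qed

text \<open>The finitely many half-spaces can be treated one at a time: those tight at
  \<open>x\<close> survive unchanged, the slack ones become the whole space.\<close>

lemma polyhedron_tangent_cone:
  fixes S :: "'a::euclidean_space set"
  assumes "polyhedron S" "x \<in> S"
  shows "polyhedron (tangent_cone x S)"
proof -
  obtain F where F: "finite F" "S = \<Inter>F" "\<forall>h\<in>F. \<exists>a b. a \<noteq> 0 \<and> h = {x. a \<bullet> x \<le> b}"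
    using assms(1) unfolding polyhedron_def by blast
  have "convex h \<and> x \<in> h" if "h \<in> F" for h
    using F(2) bspec[OF F(3) that] that assms(2) convex_halfspace_le by auto
  then have "tangent_cone x S = (\<Inter>h\<in>F. tangent_cone x h)"
    using F(1,2) tangent_cone_Inter by metis
  moreover have "polyhedron (tangent_cone x h)" if "h \<in> F" for h
  proof -
    obtain a b where h: "h = {x. a \<bullet> x \<le> b}" using F(3) \<open>h \<in> F\<close> by blast
    moreover have "x \<in> h" using F(2) \<open>h \<in> F\<close> assms(2) by blast
    ultimately have "a \<bullet> x \<le> b" by simp
    from tangent_cone_halfspace[OF this] show ?thesis
      unfolding h by (simp add: polyhedron_halfspace_le)
  qed
  ultimately show ?thesis using F(1) by auto
qed

lemma convex_tangent_cone:
  assumes "convex S" "x \<in> S"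
  shows "convex (tangent_cone x S)"
proof (rule convexI)
  fix y z and u v :: real
  assume yz: "y \<in> tangent_cone x S" "z \<in> tangent_cone x S" and uv: "0 \<le> u" "0 \<le> v" "u + v = 1"
  obtain d where d: "d > 0" "\<And>a. 0 \<le> a \<Longrightarrow> a \<le> d \<Longrightarrow> x + a *\<^sub>R (y - x) \<in> S"
    using yz assms by (auto elim: tangent_coneE)
  obtain e where e: "e > 0" "\<And>a. 0 \<le> a \<Longrightarrow> a \<le> e \<Longrightarrow> x + a *\<^sub>R (z - x) \<in> S"
    using yz assms by (auto elim: tangent_coneE)
  define m where "m = min d e"
  have "u *\<^sub>R (x + m *\<^sub>R (y - x)) + v *\<^sub>R (x + m *\<^sub>R (z - x)) \<in> S"
    using d e uv assms by (intro convexD) (auto simp: m_def)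
  also have "u *\<^sub>R (x + m *\<^sub>R (y - x)) + v *\<^sub>R (x + m *\<^sub>R (z - x)) =
      (u + v) *\<^sub>R x + m *\<^sub>R (u *\<^sub>R y + v *\<^sub>R z - (u + v) *\<^sub>R x)"
    by (simp add: algebra_simps)
  finally show "u *\<^sub>R y + v *\<^sub>R z \<in> tangent_cone x S"
    using d(1) e(1) uv(3) by (intro tangent_coneI[of m]) (auto simp: m_def)
qed

text \<open>A homothety at \<open>x\<close> with a small common factor moves the end points of a
  segment into \<open>S\<close> and its inner point into \<open>F\<close>. It preserves open
  segments, so the face property of \<open>F\<close> applies.\<close>

lemma face_of_tangent_cone:
  assumes F: "F face_of S" and "convex S" "x \<in> F"
  shows "tangent_cone x F face_of tangent_cone x S"
  unfolding face_of_def
proof (intro conjI ballI impI)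
  have xS: "x \<in> S" "F \<subseteq> S" "convex F"
    using assms face_of_imp_subset face_of_imp_convex by blast+
  show "tangent_cone x F \<subseteq> tangent_cone x S" "convex (tangent_cone x F)"
    using xS assms by (simp_all add: tangent_cone_mono convex_tangent_cone)
  fix a b y assume ab: "a \<in> tangent_cone x S" "b \<in> tangent_cone x S"
    and y: "y \<in> tangent_cone x F" "y \<in> open_segment a b"
  obtain d where d: "d > 0" "\<And>t. 0 \<le> t \<Longrightarrow> t \<le> d \<Longrightarrow> x + t *\<^sub>R (a - x) \<in> S"
    using ab assms xS by (auto elim: tangent_coneE)
  obtain e where e: "e > 0" "\<And>t. 0 \<le> t \<Longrightarrow> t \<le> e \<Longrightarrow> x + t *\<^sub>R (b - x) \<in> S"
    using ab assms xS by (auto elim: tangent_coneE)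
  obtain f where f: "f > 0" "\<And>t. 0 \<le> t \<Longrightarrow> t \<le> f \<Longrightarrow> x + t *\<^sub>R (y - x) \<in> F"
    using y assms xS by (auto elim: tangent_coneE)
  define m where "m = min d (min e f)"
  have m: "m > 0" "m \<le> d" "m \<le> e" "m \<le> f" using d e f by (auto simp: m_def)
  let ?h = "\<lambda>z. x + m *\<^sub>R (z - x)"
  obtain u where u: "a \<noteq> b" "0 < u" "u < 1" "y = (1 - u) *\<^sub>R a + u *\<^sub>R b"
    using y(2) by (auto simp: in_segment)
  have "?h y = (1 - u) *\<^sub>R ?h a + u *\<^sub>R ?h b"
    unfolding u(4) by (simp add: algebra_simps)
  moreover have "?h a \<noteq> ?h b" using u(1) m by simp
  ultimately have "?h y \<in> open_segment (?h a) (?h b)"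
    using u by (auto simp: in_segment)
  moreover have "?h a \<in> S" "?h b \<in> S" "?h y \<in> F"
    using d(2)[of m] e(2)[of m] f(2)[of m] m by auto
  ultimately have "?h a \<in> F \<and> ?h b \<in> F"
    by (rule face_ofD[OF F])
  then show "a \<in> tangent_cone x F" "b \<in> tangent_cone x F"
    using m(1) by (auto intro: tangent_coneI)
qed

section \<open>Slices of polyhedral complexes\<close>

text \<open>Closure under nonempty intersections takes the place of closure under faces. This form
  passes to slices of tangent cones, which may be unbounded, and yields a smallest cell through each
  point of the union.\<close>

definition polyhedral_complex :: "'a::euclidean_space set set \<Rightarrow> bool" where
  "polyhedral_complex C \<longleftrightarrow> finite C \<and> (\<forall>P\<in>C. polyhedron P \<and> P \<noteq> {}) \<and>
     (\<forall>P\<in>C. \<forall>Q\<in>C. (P \<inter> Q = {} \<or> P \<inter> Q \<in> C) \<and> (P \<inter> Q) face_of P)"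

lemma polytopal_imp_polyhedral_complex:
  "polytopal_complex C \<Longrightarrow> polyhedral_complex C"
  unfolding polytopal_complex_def polyhedral_complex_def
  by (meson polytope_imp_polyhedron)

text \<open>If \<open>w \<bullet> x < b\<close>, these are the cells through \<open>x\<close> that
  contain a point \<open>z\<close> with \<open>w \<bullet> (z - x) > 0\<close>.\<close>

definition cells_meeting :: "'a::euclidean_space set set \<Rightarrow> 'a \<Rightarrow> 'a \<Rightarrow> real \<Rightarrow> 'a set set" where
  "cells_meeting C x w b = {S \<in> C. x \<in> S \<and> tangent_cone x S \<inter> {y. w \<bullet> y = b} \<noteq> {}}"

definition tangent_slice :: "'a::euclidean_space \<Rightarrow> 'a \<Rightarrow> real \<Rightarrow> 'a set \<Rightarrow> 'a set" where
  "tangent_slice x w b S = tangent_cone x S \<inter> {y. w \<bullet> y = b}"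

text \<open>The slice stays in the affine hull of \<open>S\<close>, but inside a hyperplane that
  misses \<open>x\<close>. This drop drives the induction on dimension.\<close>

lemma aff_dim_slice:
  assumes x: "w \<bullet> x \<noteq> b" and "x \<in> S"
  shows "aff_dim (tangent_slice x w b S) < aff_dim S"
proof (rule aff_dim_psubset)
  let ?A = "affine hull S \<inter> {y. w \<bullet> y = b}"
  have "y \<in> affine hull S" if y: "y \<in> tangent_cone x S" for y
  proof -
    obtain e where e: "e > 0" "x + e *\<^sub>R (y - x) \<in> S" using y by (auto simp: tangent_cone_def)
    have "(1 - 1 / e) *\<^sub>R x + (1 / e) *\<^sub>R (x + e *\<^sub>R (y - x)) \<in> affine hull S"
      using e(2) assms(2) by (intro mem_affine[OF affine_affine_hull]) (auto intro: hull_inc)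
    also have "(1 - 1 / e) *\<^sub>R x + (1 / e) *\<^sub>R (x + e *\<^sub>R (y - x)) = y"
      using e(1) by (simp add: algebra_simps)
    finally show ?thesis .
  qed
  then have "tangent_slice x w b S \<subseteq> ?A" by (auto simp: tangent_slice_def)
  moreover have "affine ?A" by (simp add: affine_Int affine_hyperplane)
  ultimately have "affine hull tangent_slice x w b S \<subseteq> ?A" by (rule hull_minimal)
  moreover have "x \<in> affine hull S" "x \<notin> ?A" using x assms by (auto intro: hull_inc)
  ultimately show "affine hull tangent_slice x w b S \<subset> affine hull S" by blast
qed

context
  fixes C :: "'a::euclidean_space set set" and x w :: 'a and b :: real
  assumes C: "polyhedral_complex C" and x: "w \<bullet> x \<noteq> b"
begin

lemma cell_convex: "S \<in> C \<Longrightarrow> convex S" and cell_closed: "S \<in> C \<Longrightarrow> closed S"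
  using C by (auto simp: polyhedral_complex_def polyhedron_imp_convex polyhedron_imp_closed)

lemma slice_Int:
  assumes "S \<in> cells_meeting C x w b" "T \<in> cells_meeting C x w b"
  shows "tangent_slice x w b S \<inter> tangent_slice x w b T = tangent_slice x w b (S \<inter> T)"
  using assms tangent_cone_Int[of S T x] cell_convex by (auto simp: tangent_slice_def cells_meeting_def)

lemma polyhedral_complex_slice: "polyhedral_complex (tangent_slice x w b ` cells_meeting C x w b)"
  unfolding polyhedral_complex_def
proof (intro conjI ballI)
  show "finite (tangent_slice x w b ` cells_meeting C x w b)"
    using C by (simp add: cells_meeting_def polyhedral_complex_def)
next
  fix R assume "R \<in> tangent_slice x w b ` cells_meeting C x w b"
  then obtain S where S: "S \<in> cells_meeting C x w b" "R = tangent_slice x w b S" by blast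
  then have "polyhedron (tangent_cone x S)"
    using C by (intro polyhedron_tangent_cone) (auto simp: cells_meeting_def polyhedral_complex_def)
  then show "polyhedron R" "R \<noteq> {}"
    using S by (auto simp: tangent_slice_def cells_meeting_def polyhedron_hyperplane)
next
  fix R R' assume "R \<in> tangent_slice x w b ` cells_meeting C x w b" "R' \<in> tangent_slice x w b ` cells_meeting C x w b"
  then obtain S T where S: "S \<in> cells_meeting C x w b" "R = tangent_slice x w b S" and T: "T \<in> cells_meeting C x w b" "R' = tangent_slice x w b T" by blast
  have ST: "S \<in> C" "T \<in> C" "x \<in> S \<inter> T" using S T by (auto simp: cells_meeting_def)
  have eq: "R \<inter> R' = tangent_slice x w b (S \<inter> T)" using slice_Int S T by simp
  have "S \<inter> T \<in> C" "S \<inter> T face_of S" using C ST by (auto simp: polyhedral_complex_def)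
  then show "R \<inter> R' = {} \<or> R \<inter> R' \<in> tangent_slice x w b ` cells_meeting C x w b"
    unfolding eq using ST(3) by (auto simp: cells_meeting_def tangent_slice_def)
  have "tangent_cone x (S \<inter> T) face_of tangent_cone x S"
    using \<open>S \<inter> T face_of S\<close> ST cell_convex by (intro face_of_tangent_cone) auto
  then have "tangent_slice x w b (S \<inter> T) face_of tangent_slice x w b S"
    unfolding tangent_slice_def by (rule face_of_slice) (simp add: convex_hyperplane)
  then show "R \<inter> R' face_of R" unfolding eq unfolding S(2) .
qed

text \<open>An inclusion of slices forces into \<open>T\<close> every point of \<open>S\<close> on
  the hyperplane's side of \<open>x\<close>. Such points exist, and any other point of
  \<open>S\<close> ends a segment that starts at one and has an inner point of the same kind; as
  \<open>S \<inter> T\<close> is a face of \<open>S\<close>, that end lies in \<open>T\<close> as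
  well.\<close>

lemma slice_subset_iff:
  assumes S: "S \<in> cells_meeting C x w b" and T: "T \<in> cells_meeting C x w b"
  shows "tangent_slice x w b S \<subseteq> tangent_slice x w b T \<longleftrightarrow> S \<subseteq> T"
proof
  show "tangent_slice x w b S \<subseteq> tangent_slice x w b T" if "S \<subseteq> T"
    using tangent_cone_mono[OF that] by (auto simp: tangent_slice_def)
next
  assume sub: "tangent_slice x w b S \<subseteq> tangent_slice x w b T"
  have ST: "S \<in> C" "T \<in> C" "x \<in> S" "x \<in> T" using S T by (auto simp: cells_meeting_def)
  have face: "S \<inter> T face_of S" using C ST by (auto simp: polyhedral_complex_def)
  \<comment> \<open>An affine height with value 0 at \<open>x\<close> and 1 on the
    hyperplane.\<close>
  define h where "h y = (w \<bullet> (y - x)) / (b - w \<bullet> x)" for y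
  have h_aff: "h ((1 - t) *\<^sub>R y + t *\<^sub>R z) = (1 - t) * h y + t * h z" for t y z
    unfolding h_def by (simp add: inner_add_right inner_diff_right add_divide_distrib diff_divide_distrib algebra_simps)
  have pos: "q \<in> T" if q: "q \<in> S" "h q > 0" for q
  proof -
    \<comment> \<open>The point where the ray from \<open>x\<close> through \<open>q\<close> crosses
      the hyperplane.\<close>
    define y where "y = x + (1 / h q) *\<^sub>R (q - x)"
    have "w \<bullet> (q - x) \<noteq> 0"
      using q(2) by (metis div_0 h_def less_irrefl)
    then have "w \<bullet> y = b"
      using x unfolding y_def inner_add_right inner_scaleR_right by (simp add: h_def)
    moreover have "y \<in> tangent_cone x S"
      using q by (intro tangent_coneI[of "h q"]) (auto simp: y_def)
    ultimately have "y \<in> tangent_cone x T" using sub by (auto simp: tangent_slice_def)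
    then obtain e where e: "e > 0" "\<And>d. 0 \<le> d \<Longrightarrow> d \<le> e \<Longrightarrow> x + d *\<^sub>R (y - x) \<in> T"
      using ST cell_convex by (auto elim: tangent_coneE)
    \<comment> \<open>Staying below \<open>h q\<close> puts the new point strictly between
      \<open>x\<close> and \<open>q\<close>, where the face property applies.\<close>
    define d where "d = min e (h q / 2)"
    have d: "0 < d" "d \<le> e" "d < h q" using e q by (auto simp: d_def min_def)
    have "x + d *\<^sub>R (y - x) = (1 - d / h q) *\<^sub>R x + (d / h q) *\<^sub>R q"
      by (simp add: y_def algebra_simps)
    moreover have "h x = 0" by (simp add: h_def)
    then have "x \<noteq> q" using q(2) by auto
    ultimately have seg: "x + d *\<^sub>R (y - x) \<in> open_segment x q"
      using d by (auto simp: in_segment intro!: exI[of _ "d / h q"])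
    then have "x + d *\<^sub>R (y - x) \<in> S"
      using cell_convex ST q(1) convex_contains_open_segment by blast
    then show ?thesis
      using face_ofD[OF face seg] ST q e(2)[of d] d by simp
  qed
  obtain y where y: "y \<in> tangent_cone x S" "w \<bullet> y = b"
    using S by (auto simp: cells_meeting_def)
  then obtain e where e: "e > 0" "x + e *\<^sub>R (y - x) \<in> S" by (auto simp: tangent_cone_def)
  define q where "q = x + e *\<^sub>R (y - x)"
  have "h q = e" using y(2) x by (simp add: q_def h_def inner_diff_right)
  then have q: "q \<in> S" "h q > 0" using e by (auto simp: q_def)
  show "S \<subseteq> T"
  proof
    fix a assume a: "a \<in> S"
    show "a \<in> T"
    proof (cases "h a > 0")
      case True
      then show ?thesis using pos a by blast
    next
      case False
      \<comment> \<open>Chosen so that the height of \<open>z\<close> is half that of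
        \<open>q\<close>, hence still positive.\<close>
      define t where "t = h q / (2 * (h q - h a))"
      have t: "0 < t" "t < 1" using q(2) False by (auto simp: t_def field_simps)
      define z where "z = (1 - t) *\<^sub>R q + t *\<^sub>R a"
      have "h z = h q - t * (h q - h a)" unfolding z_def h_aff by (simp add: algebra_simps)
      also have "\<dots> = h q / 2" using q(2) False by (simp add: t_def divide_simps)
      finally have "h z > 0" using q(2) by simp
      moreover have seg: "z \<in> open_segment q a"
        using t q(2) False by (auto simp: in_segment z_def)
      moreover have "z \<in> S"
        using seg cell_convex ST q(1) a convex_contains_open_segment by blast
      ultimately have "z \<in> S \<inter> T" using pos by blast
      then show ?thesis using face_ofD[OF face seg q(1) a] by blast
    qed
  qed
qed

text \<open>Near \<open>x\<close> only the finitely many closed cells through \<open>x\<close> matter.\<close>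
lemma Union_slice:
  assumes "x \<in> \<Union>C" "convex (\<Union>C)"
  shows "\<Union>(tangent_slice x w b ` cells_meeting C x w b) = tangent_slice x w b (\<Union>C)"
proof
  show "\<Union>(tangent_slice x w b ` cells_meeting C x w b) \<subseteq> tangent_slice x w b (\<Union>C)"
  proof (rule Union_least)
    fix R assume "R \<in> tangent_slice x w b ` cells_meeting C x w b"
    then obtain S where S: "S \<in> C" "R = tangent_slice x w b S" by (auto simp: cells_meeting_def)
    then show "R \<subseteq> tangent_slice x w b (\<Union>C)"
      using tangent_cone_mono[of S "\<Union>C" x] by (auto simp: tangent_slice_def)
  qed
  show "tangent_slice x w b (\<Union>C) \<subseteq> \<Union>(tangent_slice x w b ` cells_meeting C x w b)"
  proof
    fix y assume y: "y \<in> tangent_slice x w b (\<Union>C)"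
    define N where "N = - \<Union>{S \<in> C. x \<notin> S}"
    have "open N"
      unfolding N_def using C cell_closed by (intro open_Compl closed_Union) (auto simp: polyhedral_complex_def)
    moreover have "x \<in> N" by (auto simp: N_def)
    ultimately obtain r where r: "r > 0" "ball x r \<subseteq> N" by (meson openE)
    obtain e where e: "e > 0" "\<And>d. 0 \<le> d \<Longrightarrow> d \<le> e \<Longrightarrow> x + d *\<^sub>R (y - x) \<in> \<Union>C"
      using y assms by (auto simp: tangent_slice_def elim: tangent_coneE)
    define d where "d = min e (r / (2 * (1 + norm (y - x))))"
    have pos: "1 + norm (y - x) > 0" by (simp add: add_pos_nonneg)
    have "d \<le> r / (2 * (1 + norm (y - x)))" by (simp add: d_def)
    then have "d * (1 + norm (y - x)) \<le> r / 2"
      using pos by (simp add: field_simps)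
    moreover have d: "d > 0" "d \<le> e" using e r pos by (auto simp: d_def)
    ultimately have "d * norm (y - x) < r" using r by (simp add: algebra_simps)
    then have "x + d *\<^sub>R (y - x) \<in> N" using r d by (auto simp: dist_norm)
    moreover obtain S where S: "S \<in> C" "x + d *\<^sub>R (y - x) \<in> S" using e(2)[of d] d by auto
    ultimately have "x \<in> S" by (auto simp: N_def)
    moreover have "y \<in> tangent_slice x w b S" using y S d by (auto simp: tangent_slice_def intro: tangent_coneI)
    ultimately have "S \<in> cells_meeting C x w b" using S(1) by (auto simp: cells_meeting_def tangent_slice_def)
    then show "y \<in> \<Union>(tangent_slice x w b ` cells_meeting C x w b)" using \<open>y \<in> tangent_slice x w b S\<close> by blast
  qed
qed

end

section \<open>Smallest cells and removal in order of distance\<close>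

lemma polyhedral_complex_Inter:
  assumes C: "polyhedral_complex C" and "finite F" "F \<noteq> {}" "F \<subseteq> C" "y \<in> \<Inter>F"
  shows "\<Inter>F \<in> C"
  using assms(2-)
proof (induction F rule: finite_ne_induct)
  case (singleton S)
  then show ?case by simp
next
  case (insert S F)
  \<comment> \<open>The common point \<open>y\<close> keeps each partial intersection nonempty, so
    that it is again a cell.\<close>
  then have "\<Inter>F \<in> C" "S \<in> C" "y \<in> S \<inter> \<Inter>F" by auto
  then show ?case using C unfolding polyhedral_complex_def by (metis Inter_insert empty_iff)
qed

text \<open>Among the cells that realise their distance \<open>m\<close> at the same point, the smallest one, \<open>tau\<close>,
  is removed last.\<close>
theorem collapsible_order_complex_polyhedral:
  fixes C :: "'a::euclidean_space set set"
  assumes "polyhedral_complex C" and "convex (\<Union>C)" and "C \<noteq> {}"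
  shows "collapsible (order_complex C)"
  using assms
proof (induction "nat (aff_dim (\<Union>C))" arbitrary: C rule: less_induct)
  case less
  note C = less.prems(1) and conv = less.prems(2) and IH = less.hyps
  have cell: "convex S" "closed S" "S \<noteq> {}" if "S \<in> C" for S
    using C that by (auto simp: polyhedral_complex_def polyhedron_imp_convex polyhedron_imp_closed)
  have finC: "finite C" using C by (simp add: polyhedral_complex_def)
  obtain x0 where x0: "x0 \<in> \<Union>C" using less.prems(3) cell(3) by blast
  define a where "a S = closest_point S x0" for S
  define m where "m S = dist x0 (a S)" for S
  define tau where "tau S = \<Inter>{T \<in> C. a S \<in> T}" for S
  have a_in: "a S \<in> S" if "S \<in> C" for S
    using closest_point_in_set[OF cell(2,3)] that by (simp add: a_def)
  have m_le: "m S \<le> dist x0 y" if "S \<in> C" "y \<in> S" for S y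
    using closest_point_le[OF cell(2)] that by (simp add: a_def m_def)
  have a_eq: "a S = y" if "S \<in> C" "y \<in> S" "dist x0 y \<le> m S" for S y
  proof -
    have "\<forall>z\<in>S. dist x0 y \<le> dist x0 z"
      using m_le[OF that(1)] that(3) by (meson order_trans)
    then show ?thesis
      using closest_point_unique[OF cell(1,2) that(2)] that(1) by (simp add: a_def)
  qed
  have tau_in: "tau S \<in> C" "a S \<in> tau S" if "S \<in> C" for S
    using that a_in finC C unfolding tau_def by (auto intro!: polyhedral_complex_Inter[of _ _ "a S"])
  have tau_le: "tau S \<subseteq> T" if "T \<in> C" "a S \<in> T" for S T
    using that by (auto simp: tau_def)
  have tau_cong: "tau S = tau T" if "a S = a T" for S T
    using that by (simp add: tau_def)
  \<comment> \<open>\<open>tau S\<close> lies in \<open>S\<close> and contains \<open>a S\<close>,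
    so its nearest point is the same.\<close>
  have a_tau: "a (tau S) = a S" if "S \<in> C" for S
  proof (rule a_eq)
    have "a (tau S) \<in> S" using a_in tau_in tau_le that by blast
    then show "dist x0 (a S) \<le> m (tau S)" using m_le that by (simp add: m_def)
  qed (use tau_in that in auto)
  \<comment> \<open>Inner induction over the families left during the removal: along with a cell
    they contain every strictly closer cell and the smallest cell at its nearest point.\<close>
  have "collapsible (order_complex Q)"
    if "Q \<subseteq> C" "Q \<noteq> {}" "\<And>S T. S \<in> Q \<Longrightarrow> T \<in> C \<Longrightarrow> m T < m S \<Longrightarrow> T \<in> Q"
      "\<And>S. S \<in> Q \<Longrightarrow> tau S \<in> Q" for Q
    using that
  proof (induction "card Q" arbitrary: Q rule: less_induct)
    case (less Q)
    note Q = less.prems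
    have QC: "S \<in> C" if "S \<in> Q" for S using Q(1) that by blast
    have finQ: "finite Q" using Q(1) finC finite_subset by blast
    define M where "M = Max (m ` Q)"
    have M: "m S \<le> M" if "S \<in> Q" for S using finQ that by (simp add: M_def)
    \<comment> \<open>The invariant survives: no member needs a farthest cell as a strictly closer
      one, and by \<open>tau\<close> no other member needs \<open>S\<close> as its smallest
      cell.\<close>
    have remove: "collapsible (order_complex (Q - {S}))"
      if S: "S \<in> Q" "m S = M" and ne: "Q - {S} \<noteq> {}"
        and tau: "\<And>T. T \<in> Q \<Longrightarrow> T \<noteq> S \<Longrightarrow> tau T \<noteq> S" for S
    proof (rule less.hyps)
      show "card (Q - {S}) < card Q" using finQ S(1) by (rule card_Diff1_less)
      show "Q - {S} \<subseteq> C" using Q(1) by blast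
      show "T \<in> Q - {S}" if "S' \<in> Q - {S}" "T \<in> C" "m T < m S'" for S' T
        using that Q(3)[of S' T] M[of S'] S(2) by auto
      show "tau T \<in> Q - {S}" if "T \<in> Q - {S}" for T
        using that Q(4) tau by blast
    qed (rule ne)
    \<comment> \<open>Farthest cells that are not smallest at their nearest point go first. If there
      are none, either all remaining cells contain \<open>x0\<close>, or a smallest farthest cell is
      removed.\<close>
    consider (top) S where "S \<in> Q" "m S = M" "tau S \<noteq> S"
      | (zero) "M = 0"
      | (min) S where "S \<in> Q" "m S = M" "M \<noteq> 0" "\<And>T. T \<in> Q \<Longrightarrow> m T = M \<Longrightarrow> tau T = T"
    proof -
      have "M \<in> m ` Q" unfolding M_def using finQ Q(2) by simp
      then obtain S where "S \<in> Q" "m S = M" by blast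
      then show thesis using that by metis
    qed
    then show ?case
    proof cases
      case top
      \<comment> \<open>No member of \<open>Q\<close> is farther than \<open>S\<close>, and a subset
        of \<open>S\<close> cannot be closer; so the nearest points agree and \<open>T\<close>
        contains \<open>tau S\<close>, the apex of the cone.\<close>
      have aT: "a T = a S" if T: "T \<in> Q" "T \<subset> S" for T
      proof -
        have "a T \<in> S" using a_in QC T by blast
        moreover have "m T \<le> m S" using M T top by simp
        ultimately show ?thesis
          using a_eq[of S "a T"] QC top(1) by (simp add: m_def)
      qed
      have "collapsible (order_complex {T \<in> Q. T \<subset> S \<or> S \<subset> T})"
      proof (rule collapsible_order_complex_cone)
        have "tau S \<subseteq> S" using tau_le a_in QC top(1) by blast
        then show "tau S \<in> {T \<in> Q. T \<subset> S \<or> S \<subset> T}" using top Q(4) by blast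
        show "T \<subseteq> tau S \<or> tau S \<subseteq> T" if T: "T \<in> {T \<in> Q. T \<subset> S \<or> S \<subset> T}" for T
        proof (cases "T \<subset> S")
          case True
          then have "a S \<in> T" using aT a_in QC T by (metis (no_types, lifting) mem_Collect_eq)
          then show ?thesis using tau_le QC T by blast
        next
          case False
          then show ?thesis using T \<open>tau S \<subseteq> S\<close> by blast
        qed
      qed (use finQ in simp)
      moreover have "collapsible (order_complex (Q - {S}))"
      proof (rule remove)
        show "Q - {S} \<noteq> {}" using Q(4)[OF top(1)] top(3) by blast
        \<comment> \<open>Since \<open>tau (tau T) = tau T\<close>, a cell moved by
          \<open>tau\<close> is not a value of \<open>tau\<close>.\<close>
        show "tau T \<noteq> S" if "T \<in> Q" for T
          using a_tau[of T] tau_cong[of "tau T" T] top(3) that QC by metis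
      qed (use top in auto)
      ultimately show ?thesis using order_complex_remove top(1) by blast
    next
      case zero
      \<comment> \<open>All nearest points are \<open>x0\<close>, so \<open>tau S\<close> is the
        smallest cell through \<open>x0\<close> and lies below every member of
        \<open>Q\<close>.\<close>
      have a0: "a T = x0" if "T \<in> Q" for T
        using M[OF that] zero unfolding m_def by simp
      obtain S where "S \<in> Q" using Q(2) by blast
      show ?thesis
      proof (rule collapsible_order_complex_cone)
        show "tau S \<in> Q" using Q(4) \<open>S \<in> Q\<close> by blast
        show "T \<subseteq> tau S \<or> tau S \<subseteq> T" if "T \<in> Q" for T
          using tau_le[of T S] a_in[of T] a0 that \<open>S \<in> Q\<close> QC by metis
      qed (rule finQ)
    next
      case min
      have S: "S \<in> C" "tau S = S" using min QC by auto
      define x where "x = a S"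
      define w where "w = x0 - x"
      \<comment> \<open>The hyperplane lies at height 1 above \<open>x\<close> in direction
        \<open>w\<close>; any point of positive height can be rescaled onto it along its ray from
        \<open>x\<close>.\<close>
      define b where "b = w \<bullet> x + 1"
      have mS: "m S = norm w" by (simp add: m_def x_def w_def dist_norm)
      have wx: "w \<bullet> x \<noteq> b" by (simp add: b_def)
      have xS: "x \<in> S" using a_in S by (simp add: x_def)
      have in_H: "x + (1 / k) *\<^sub>R (y - x) \<in> {y. w \<bullet> y = b}" if "w \<bullet> (y - x) = k" "k > 0" for y k
        using that by (simp add: b_def inner_add_right)
      have in_T: "x + (1 / k) *\<^sub>R (y - x) \<in> tangent_cone x T" if "y \<in> T" "k > 0" for y k T
        using that by (intro tangent_coneI[of k]) auto
      let ?L = "cells_meeting C x w b"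
      have "{T \<in> Q. T \<subset> S \<or> S \<subset> T} = ?L"
      proof
        show "{T \<in> Q. T \<subset> S \<or> S \<subset> T} \<subseteq> ?L"
        proof
          fix T assume T: "T \<in> {T \<in> Q. T \<subset> S \<or> S \<subset> T}"
          then have TQ: "T \<in> Q" "T \<in> C" "m T \<le> m S" using QC M min(2) by auto
          \<comment> \<open>Such a \<open>T\<close> would have the same nearest point as
            \<open>S\<close>, and \<open>S = tau S\<close> would be contained in it.\<close>
          have "\<not> T \<subset> S"
          proof
            assume "T \<subset> S"
            then have "a T \<in> S" using a_in TQ by blast
            then have "a S = a T" using a_eq[of S "a T"] S TQ by (simp add: m_def)
            then have "S \<subseteq> T" using tau_le[of T S] S TQ a_in[of T] by simp
            then show False using \<open>T \<subset> S\<close> by blast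
          qed
          then have "S \<subset> T" using T by blast
          \<comment> \<open>With equal distances \<open>T\<close> would share the nearest point of
            \<open>S\<close>, so \<open>tau T = S\<close>; but \<open>T\<close>, being farthest, is
            its own \<open>tau\<close>.\<close>
          have "m T \<noteq> m S"
          proof
            assume eq: "m T = m S"
            have "a S \<in> T" using \<open>S \<subset> T\<close> a_in[OF S(1)] by blast
            then have "a T = a S" using a_eq[of T "a S"] TQ eq by (simp add: m_def)
            then have "tau T = S" using tau_cong S by metis
            then show False using min(4)[of T] TQ eq min(2) \<open>S \<subset> T\<close> by simp
          qed
          then have "norm (x0 - a T) < norm w" using TQ mS by (simp add: m_def dist_norm)
          then have "(x0 - a T) \<bullet> (x0 - a T) < w \<bullet> w"
            by (simp add: norm_lt)
          \<comment> \<open>With \<open>x0 - a T = w - (a T - x)\<close>, being shorter than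
            \<open>w\<close> forces \<open>a T - x\<close> to have a positive inner product with
            \<open>w\<close>.\<close>
          moreover have "(x0 - a T) \<bullet> (x0 - a T) = w \<bullet> w - 2 * (w \<bullet> (a T - x)) + (a T - x) \<bullet> (a T - x)"
            by (simp add: w_def inner_diff_left inner_diff_right inner_commute algebra_simps)
          ultimately have "w \<bullet> (a T - x) > 0" using inner_ge_zero[of "a T - x"] by linarith
          then have "x + (1 / (w \<bullet> (a T - x))) *\<^sub>R (a T - x) \<in> tangent_cone x T \<inter> {y. w \<bullet> y = b}"
            using in_H in_T a_in TQ by blast
          then have "tangent_cone x T \<inter> {y. w \<bullet> y = b} \<noteq> {}" by blast
          then show "T \<in> ?L" using TQ(2) \<open>S \<subset> T\<close> xS unfolding cells_meeting_def by blast
        qed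
        show "?L \<subseteq> {T \<in> Q. T \<subset> S \<or> S \<subset> T}"
        proof
          fix T assume "T \<in> ?L"
          then obtain y where T: "T \<in> C" "x \<in> T" and y: "y \<in> tangent_cone x T" "w \<bullet> y = b"
            by (auto simp: cells_meeting_def)
          obtain e where e: "e > 0" "x + e *\<^sub>R (y - x) \<in> T" using y(1) by (auto simp: tangent_cone_def)
          \<comment> \<open>Otherwise \<open>x\<close> would be the point of \<open>T\<close>
            nearest to \<open>x0\<close>, and no point of \<open>T\<close> could have positive
            height over \<open>x\<close>; but \<open>x + e *\<^sub>R (y - x)\<close> has height
            \<open>e\<close>.\<close>
          have "m T < m S"
          proof (rule ccontr)
            assume "\<not> m T < m S"
            then have "\<forall>z\<in>T. dist x0 x \<le> dist x0 z"
              using m_le[OF T(1)] unfolding m_def[of S] x_def by (meson leI order_trans)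
            then have "(x0 - x) \<bullet> (x + e *\<^sub>R (y - x) - x) \<le> 0"
              using any_closest_point_dot cell T e(2) by blast
            then show False
              using e(1) y(2) by (simp add: b_def inner_diff_right flip: w_def)
          qed
          moreover have "S \<subseteq> T" using tau_le[of T S] T S by (simp add: x_def)
          ultimately show "T \<in> {T \<in> Q. T \<subset> S \<or> S \<subset> T}"
            using Q(3)[OF min(1) T(1)] by auto
        qed
      qed
      moreover have "collapsible (order_complex ?L)"
      proof (rule collapsible_order_complex_embedding)
        have xC: "x \<in> \<Union>C" using xS S by blast
        have U: "\<Union>(tangent_slice x w b ` ?L) = tangent_slice x w b (\<Union>C)"
          using Union_slice[OF C wx xC conv] .
        have "w \<noteq> 0" using mS min(2,3) by auto
        \<comment> \<open>The point \<open>x0\<close>, rescaled along its ray from \<open>x\<close>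
          to height 1, shows that the slice of the union is nonempty.\<close>
        then have "x + (1 / (w \<bullet> w)) *\<^sub>R (x0 - x) \<in> tangent_slice x w b (\<Union>C)"
          using in_H[of x0 "w \<bullet> w"] in_T[of x0 "\<Union>C" "w \<bullet> w"] x0 by (simp add: tangent_slice_def w_def)
        then have ne: "tangent_slice x w b (\<Union>C) \<noteq> {}" by blast
        show "collapsible (order_complex (tangent_slice x w b ` ?L))"
        proof (rule IH)
          \<comment> \<open>A nonempty slice has nonnegative dimension, so \<open>nat\<close>
            preserves the strict drop.\<close>
          show "nat (aff_dim (\<Union>(tangent_slice x w b ` ?L))) < nat (aff_dim (\<Union>C))"
            unfolding U using aff_dim_slice[OF wx xC] ne
            by (smt (verit) aff_dim_negative_iff zless_nat_conj)
          show "polyhedral_complex (tangent_slice x w b ` ?L)"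
            by (rule polyhedral_complex_slice[OF C wx])
          show "convex (\<Union>(tangent_slice x w b ` ?L))"
            unfolding U tangent_slice_def
            by (intro convex_Int convex_tangent_cone conv xC convex_hyperplane)
          show "tangent_slice x w b ` ?L \<noteq> {}" using U ne by auto
        qed
        show "tangent_slice x w b A \<subseteq> tangent_slice x w b B \<longleftrightarrow> A \<subseteq> B" if "A \<in> ?L" "B \<in> ?L" for A B
          using slice_subset_iff[OF C wx that] .
      qed
      ultimately have 1: "collapsible (order_complex {T \<in> Q. T \<subset> S \<or> S \<subset> T})" by simp
      have "collapsible (order_complex (Q - {S}))"
      proof (rule remove)
        \<comment> \<open>A cell through \<open>x0\<close> has distance 0 and so is still in
          \<open>Q\<close>; it keeps the rest nonempty.\<close>
        obtain T where T: "T \<in> C" "x0 \<in> T" using x0 by blast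
        then have "m T \<le> 0" using m_le[of T x0] by simp
        moreover have "m S > 0" using min(2,3) mS by auto
        ultimately have "T \<in> Q" "T \<noteq> S" using Q(3)[OF min(1) T(1)] by auto
        then show "Q - {S} \<noteq> {}" by blast
        show "tau T \<noteq> S" if T: "T \<in> Q" "T \<noteq> S" for T
        proof
          assume eq: "tau T = S"
          then have "a T = a S" using a_tau QC T by metis
          then have "m T = M" using min(2) by (simp add: m_def)
          then show False using min(4) T eq by simp
        qed
      qed (use min in auto)
      with 1 show ?thesis using order_complex_remove min(1) by blast
    qed
  qed
  then show ?case using less.prems(3) tau_in by blast
qed

section \<open>The derived subdivision\<close>

lemma polytopal_complexD:
  assumes "polytopal_complex C" "S \<in> C"
  shows "convex S" "S \<noteq> {}" "\<And>T. T \<in> C \<Longrightarrow> S \<inter> T face_of S"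
proof -
  have "polytope S \<and> S \<noteq> {}"
    using assms(1)[unfolded polytopal_complex_def, THEN conjunct2, THEN conjunct1] assms(2) by (rule bspec)
  moreover have "\<forall>T\<in>C. S \<inter> T face_of S \<and> S \<inter> T face_of T"
    using assms(1)[unfolded polytopal_complex_def, THEN conjunct2, THEN conjunct2, THEN conjunct2] assms(2)
    by (rule bspec)
  ultimately show "convex S" "S \<noteq> {}" "\<And>T. T \<in> C \<Longrightarrow> S \<inter> T face_of S"
    by (simp_all add: polytope_imp_convex)
qed

text \<open>\<open>S \<inter> T\<close> is a face of \<open>S\<close> that meets its relative
  interior, hence all of \<open>S\<close>.\<close>

lemma polytopal_complex_subset:
  assumes "polytopal_complex C" "S \<in> C" "T \<in> C" "y \<in> rel_interior S" "y \<in> T"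
  shows "S \<subseteq> T"
  using subset_of_face_of[OF polytopal_complexD(3)[OF assms(1-3)] subset_refl]
    assms(4,5) rel_interior_subset by blast

text \<open>A smaller cell is a proper face. Hence in an order of decreasing dimension no cell
  precedes a larger one.\<close>

lemma polytopal_complex_aff_dim_less:
  assumes "polytopal_complex C" "S \<in> C" "T \<in> C" "S \<subset> T"
  shows "aff_dim S < aff_dim T"
proof -
  have "T \<inter> S = S" using assms(4) by blast
  then have "S face_of T" using polytopal_complexD(3)[OF assms(1,3,2)] by simp
  then show ?thesis
    using face_of_aff_dim_lt[of T S] polytopal_complexD(1)[OF assms(1,3)] assms(4) by blast
qed

text \<open>A point of the hull lies in the relative interior of the largest member of the chain
  whose apex has positive weight.\<close>
lemma convex_hull_chain_cases:
  fixes c :: "'a::euclidean_space set set"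
  assumes "finite c" "chain_subset c" "\<And>q. q \<in> c \<Longrightarrow> convex q \<and> p q \<in> rel_interior q \<and> r \<subseteq> q"
    and "convex r" "y \<in> convex hull (r \<union> p ` c)"
  shows "y \<in> r \<or> (\<exists>q\<in>c. y \<in> rel_interior q)"
  using assms
proof (induction "card c" arbitrary: c y rule: less_induct)
  case less
  show ?case
  proof (cases "c = {}")
    case True
    then show ?thesis using less.prems by (simp add: hull_same)
  next
    case False
    \<comment> \<open>A finite nonempty chain contains its union, so this is its largest
      member.\<close>
    define q where "q = \<Union>c"
    have "subset.chain UNIV c"
      using less.prems(2) by (simp add: subset_chain_def chain_subset_def)
    then have q: "q \<in> c"
      unfolding q_def using less.prems(1) False by (rule_tac Union_in_chain)
    define c' where "c' = c - {q}"
    have c: "c = insert q c'" and c': "c' \<subseteq> c" using q by (auto simp: c'_def)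
    have IH: "z \<in> r \<or> (\<exists>q\<in>c'. z \<in> rel_interior q)" if "z \<in> convex hull (r \<union> p ` c')" for z
    proof (rule less.hyps)
      show "card c' < card c" unfolding c'_def using less.prems(1) q by (rule card_Diff1_less)
      show "chain_subset c'" using less.prems(2) c' by (auto simp: chain_subset_def)
    qed (use less.prems c' that finite_subset in auto)
    have y: "y \<in> convex hull (insert (p q) (r \<union> p ` c'))"
      using less.prems(5) unfolding c by simp
    show ?thesis
    proof (cases "r \<union> p ` c' = {}")
      case True
      then have "y = p q" using y by simp
      then show ?thesis using less.prems(3) q by blast
    next
      case False
      obtain u v z where uv: "u \<ge> 0" "v \<ge> 0" "u + v = 1" and z: "z \<in> convex hull (r \<union> p ` c')"
        and y_eq: "y = u *\<^sub>R p q + v *\<^sub>R z"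
        using y unfolding convex_hull_insert[OF False] by blast
      show ?thesis
      proof (cases "u = 0")
        case True
        then have "y = z" using y_eq uv by simp
        then show ?thesis using IH[OF z] c' by blast
      next
        case u: False
        \<comment> \<open>With positive weight on \<open>p q\<close>, the point \<open>y\<close>
          lies on the segment from \<open>z\<close> in \<open>q\<close> to the relative interior
          point \<open>p q\<close>, away from \<open>z\<close>.\<close>
        have "p q' \<in> q" if "q' \<in> c" for q'
          using less.prems(3)[OF that] rel_interior_subset that unfolding q_def by blast
        then have "r \<union> p ` c' \<subseteq> q" using less.prems(3)[OF q] c' by blast
        then have "z \<in> q" using z less.prems(3)[OF q] hull_minimal by blast
        then have "z - u *\<^sub>R (z - p q) \<in> rel_interior q"
          using less.prems(3)[OF q] u uv by (intro rel_interior_convex_shrink[of q]) auto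
        moreover have "z - u *\<^sub>R (z - p q) = (1 - u) *\<^sub>R z + u *\<^sub>R p q"
          by (simp add: algebra_simps)
        moreover have "1 - u = v" using uv(3) by simp
        ultimately have "y \<in> rel_interior q" by (simp add: y_eq add.commute)
        then show ?thesis using q by blast
      qed
    qed
  qed
qed

text \<open>The complex reached after the stellar subdivisions at the faces in \<open>S\<close>.\<close>
definition partial_derived :: "'a::euclidean_space set set \<Rightarrow> ('a set \<Rightarrow> 'a) \<Rightarrow> 'a set set \<Rightarrow> 'a set set" where
  "partial_derived C p S = {convex hull (r \<union> p ` c) | r c.
     (r \<in> C - S \<or> r = {}) \<and> c \<subseteq> S \<and> chain_subset c \<and> (\<forall>q\<in>c. r \<subset> q) \<and> (r \<noteq> {} \<or> c \<noteq> {})}"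

lemma partial_derivedI:
  assumes "r \<in> C - S \<or> r = {}" "c \<subseteq> S" "chain_subset c" "\<forall>q\<in>c. r \<subset> q" "r \<noteq> {} \<or> c \<noteq> {}"
  shows "convex hull (r \<union> p ` c) \<in> partial_derived C p S"
  unfolding partial_derived_def using assms by blast

section \<open>Stellar subdivisions as hulls over chains\<close>

context
  fixes C :: "'a::euclidean_space set set" and p :: "'a set \<Rightarrow> 'a"
  assumes C: "polytopal_complex C" and p: "\<And>s. s \<in> C \<Longrightarrow> p s \<in> rel_interior s"
begin

text \<open>Distinct cells have disjoint relative interiors, so the position of \<open>p s\<close>
  identifies \<open>s\<close>. This recovers inclusions between chains from inclusions between
  hulls.\<close>

lemma apex_in_hull_cases:
  assumes s: "s \<in> C" and c: "c \<subseteq> C" "chain_subset c" and r: "r \<in> C \<or> r = {}" "\<And>q. q \<in> c \<Longrightarrow> r \<subset> q"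
    and ps: "p s \<in> convex hull (r \<union> p ` c)"
  shows "s \<subseteq> r \<or> s \<in> c"
proof -
  have "finite c" using c(1) C finite_subset by (auto simp: polytopal_complex_def)
  moreover have "convex q \<and> p q \<in> rel_interior q \<and> r \<subseteq> q" if "q \<in> c" for q
    using that c(1) p r(2) polytopal_complexD(1)[OF C] by blast
  moreover have "convex r" using r(1) polytopal_complexD(1)[OF C] by auto
  ultimately consider "p s \<in> r" | q where "q \<in> c" "p s \<in> rel_interior q"
    using convex_hull_chain_cases[OF _ c(2) _ _ ps] by blast
  then show ?thesis
  proof cases
    case 1
    then have "r \<in> C" using r(1) by auto
    then show ?thesis using polytopal_complex_subset[OF C s _ p[OF s] 1] by blast
  next
    case 2
    then have "q \<in> C" using c(1) by blast
    have "p s \<in> q" "p s \<in> s" using 2(2) p[OF s] rel_interior_subset by blast+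
    then have "s = q"
      using polytopal_complex_subset[OF C s \<open>q \<in> C\<close> p[OF s]]
        polytopal_complex_subset[OF C \<open>q \<in> C\<close> s 2(2)] by blast
    then show ?thesis using 2(1) by blast
  qed
qed

text \<open>As every cell above \<open>s\<close> is already treated, a hull over \<open>r\<close>
  and \<open>c\<close> contains \<open>s\<close> only if \<open>r = s\<close>. Inserting
  \<open>p s\<close> and coning then gives exactly the hulls whose chain contains \<open>s\<close>:
  the other chain members lie above \<open>s\<close>, and \<open>r\<close> lies below it.\<close>

lemma stellar_partial_derived:
  assumes S: "S \<subseteq> C" and s: "s \<in> C - S"
    and below: "\<And>q. q \<in> S \<Longrightarrow> \<not> q \<subset> s" and above: "\<And>r. r \<in> C - S \<Longrightarrow> \<not> s \<subset> r"
  shows "stellar (partial_derived C p S) s (p s) = partial_derived C p (insert s S)"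
proof
  let ?K = "partial_derived C p S" and ?L = "partial_derived C p (insert s S)"
  have sC: "s \<in> C" "s \<notin> S" "s \<noteq> {}" using s polytopal_complexD(2)[OF C] by auto
  have ps: "p s \<in> s" using p[OF sC(1)] rel_interior_subset by blast
  have base: "r = s"
    if "s \<subseteq> convex hull (r \<union> p ` c)" "r \<in> C - S \<or> r = {}" "c \<subseteq> S" "chain_subset c" "\<And>q. q \<in> c \<Longrightarrow> r \<subset> q"
    for r c
  proof -
    have "s \<subseteq> r \<or> s \<in> c"
      using that S ps by (intro apex_in_hull_cases[OF sC(1)]) auto
    then have "s \<subseteq> r" using that(3) sC(2) by blast
    then show ?thesis using that(2) above[of r] sC(3) by blast
  qed
  have hull: "convex hull (r \<union> p ` insert s c) = convex hull (insert (p s) (convex hull (r \<union> p ` c)))" for r c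
    using hull_insert[of convex "p s" "r \<union> p ` c"] by simp
  show "stellar ?K s (p s) \<subseteq> ?L"
  proof
    fix t assume "t \<in> stellar ?K s (p s)"
    then consider (old) "t \<in> ?K" "\<not> s \<subseteq> t"
      | (cone) t' t'' where "t' \<in> ?K" "\<not> s \<subseteq> t'" "t'' \<in> ?K" "s \<subseteq> t''" "t' \<subseteq> t''"
        "t = convex hull (insert (p s) t')"
      | (apex) "t = {p s}"
      unfolding stellar_def by blast
    then show "t \<in> ?L"
    proof cases
      case old
      obtain r c where t: "t = convex hull (r \<union> p ` c)" "r \<in> C - S \<or> r = {}" "c \<subseteq> S"
        "chain_subset c" "\<forall>q\<in>c. r \<subset> q" "r \<noteq> {} \<or> c \<noteq> {}"
        using old(1) unfolding partial_derived_def by blast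
      have "r \<subseteq> t" unfolding t(1) using hull_subset[of "r \<union> p ` c" convex] by blast
      then have "r \<in> C - insert s S \<or> r = {}" using old(2) t(2) by blast
      moreover have "c \<subseteq> insert s S" using t(3) by blast
      ultimately show ?thesis unfolding t(1) using t(4-6) by (rule partial_derivedI)
    next
      case cone
      obtain r c where t': "t' = convex hull (r \<union> p ` c)" "r \<in> C - S \<or> r = {}" "c \<subseteq> S"
        "chain_subset c" "\<forall>q\<in>c. r \<subset> q" "r \<noteq> {} \<or> c \<noteq> {}"
        using cone(1) unfolding partial_derived_def by blast
      obtain r' c' where t'': "t'' = convex hull (r' \<union> p ` c')" "r' \<in> C - S \<or> r' = {}" "c' \<subseteq> S"
        "chain_subset c'" "\<forall>q\<in>c'. r' \<subset> q"
        using cone(3) unfolding partial_derived_def by blast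
      have "r' = s" using base[of r' c'] t'' cone(4) by blast
      \<comment> \<open>The apexes of \<open>r\<close> and of the members of \<open>c\<close> lie in
        \<open>t''\<close>; locating them there shows that \<open>r\<close> is below
        \<open>s\<close> and that the members of \<open>c\<close> are above it.\<close>
      have in_t'': "q \<subseteq> s \<or> q \<in> c'" if "q \<in> C" "p q \<in> t''" for q
        using apex_in_hull_cases[OF that(1), of c' s] that(2) t'' S sC(1) \<open>r' = s\<close> by blast
      have "r \<subseteq> t'" "p ` c \<subseteq> t'" unfolding t'(1) using hull_subset[of "r \<union> p ` c" convex] by blast+
      have "r \<noteq> s" using \<open>r \<subseteq> t'\<close> cone(2) by blast
      have "r \<subset> s"
      proof (cases "r = {}")
        case False
        then have r: "r \<in> C" "r \<notin> S" using t'(2) by auto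
        then have "p r \<in> t''" using p rel_interior_subset \<open>r \<subseteq> t'\<close> cone(5) by blast
        then have "r \<subseteq> s" using in_t'' r t''(3) by blast
        then show ?thesis using \<open>r \<noteq> s\<close> by blast
      qed (use sC(3) in blast)
      have "s \<subset> q" if "q \<in> c" for q
      proof -
        have q: "q \<in> S" "p q \<in> t''" using that t'(3) \<open>p ` c \<subseteq> t'\<close> cone(5) by blast+
        then have "q \<subseteq> s \<or> q \<in> c'" using in_t'' S by blast
        then show ?thesis using below[OF q(1)] q(1) sC(2) t''(5) \<open>r' = s\<close> by blast
      qed
      then have "chain_subset (insert s c)" "\<forall>q\<in>insert s c. r \<subset> q"
        using t'(4,5) \<open>r \<subset> s\<close> by (auto simp: chain_subset_def)
      moreover have "t = convex hull (r \<union> p ` insert s c)"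
        unfolding hull cone(6) t'(1) ..
      moreover have "r \<in> C - insert s S \<or> r = {}" using t'(2) \<open>r \<noteq> s\<close> by blast
      moreover have "insert s c \<subseteq> insert s S" using t'(3) by blast
      ultimately show ?thesis by (metis partial_derivedI insert_not_empty)
    next
      case apex
      have "t = convex hull ({} \<union> p ` {s})" by (simp add: apex)
      also have "\<dots> \<in> ?L"
        using sC(3) by (intro partial_derivedI) (auto simp: chain_subset_def)
      finally show ?thesis .
    qed
  qed
  show "?L \<subseteq> stellar ?K s (p s)"
  proof
    fix t assume "t \<in> ?L"
    then obtain r c where t: "t = convex hull (r \<union> p ` c)" "r \<in> C - insert s S \<or> r = {}" "c \<subseteq> insert s S"
      "chain_subset c" "\<forall>q\<in>c. r \<subset> q" "r \<noteq> {} \<or> c \<noteq> {}"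
      unfolding partial_derived_def by blast
    define c0 where "c0 = c - {s}"
    have c0: "c0 \<subseteq> S" "chain_subset c0" "\<forall>q\<in>c0. r \<subset> q"
      using t by (auto simp: c0_def chain_subset_def)
    have r: "r \<in> C - S \<or> r = {}" "r \<noteq> s" using t(2) sC(3) by auto
    define t' where "t' = convex hull (r \<union> p ` c0)"
    have t'_K: "t' \<in> ?K" if "r \<noteq> {} \<or> c0 \<noteq> {}"
      unfolding t'_def using c0 r(1) that by (intro partial_derivedI)
    have t'_s: "\<not> s \<subseteq> t'" unfolding t'_def using base[of r c0] c0 r by blast
    show "t \<in> stellar ?K s (p s)"
    proof (cases "s \<in> c")
      case False
      then have "c0 = c" by (simp add: c0_def)
      then show ?thesis using t'_K t'_s t(1,6) unfolding t'_def stellar_def by simp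
    next
      case True
      then have c: "c = insert s c0" by (auto simp: c0_def)
      have t_eq: "t = convex hull (insert (p s) t')" unfolding t(1) c hull t'_def ..
      show ?thesis
      proof (cases "r = {} \<and> c0 = {}")
        case True
        then have "t = {p s}" using t(1) c by simp
        then show ?thesis unfolding stellar_def by blast
      next
        case False
        \<comment> \<open>Exchanging \<open>r\<close> for \<open>s\<close> over the same chain gives
          a face that shows \<open>t'\<close> to be in the closed star of \<open>s\<close>.\<close>
        define t'' where "t'' = convex hull (s \<union> p ` c0)"
        have "\<forall>q\<in>c0. s \<subset> q"
        proof
          fix q assume q: "q \<in> c0"
          then have "q \<subseteq> s \<or> s \<subseteq> q" using t(4) True by (auto simp: chain_subset_def c0_def)
          moreover have "q \<noteq> s" using q by (simp add: c0_def)
          moreover have "\<not> q \<subset> s" using q c0(1) below by blast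
          ultimately show "s \<subset> q" by blast
        qed
        then have "t'' \<in> ?K"
          unfolding t''_def using c0 s sC(3) by (intro partial_derivedI) auto
        moreover have "s \<subseteq> t''" unfolding t''_def using hull_subset[of "s \<union> p ` c0" convex] by blast
        moreover have "t' \<subseteq> t''" unfolding t'_def t''_def
          using t(5) True by (intro hull_mono) blast
        moreover have "t' \<in> ?K" using t'_K False by blast
        ultimately have "\<exists>r. t = convex hull (insert (p s) r) \<and> r \<in> ?K \<and> \<not> s \<subseteq> r \<and> (\<exists>t\<in>?K. s \<subseteq> t \<and> r \<subseteq> t)"
          using t_eq t'_s by blast
        then show ?thesis unfolding stellar_def by blast
      qed
    qed
  qed
qed

text \<open>Induction on the treated prefix \<open>xs\<close>, carrying along the untreated
  \<open>ys\<close>: the order of the whole list ensures that no treated cell lies below the next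
  one and no untreated cell above it.\<close>

lemma fold_stellar:
  assumes "distinct (xs @ ys)" "set (xs @ ys) = C" "sorted_wrt (\<lambda>s t. \<not> s \<subset> t) (xs @ ys)"
  shows "fold (\<lambda>s K. stellar K s (p s)) xs C = partial_derived C p (set xs)"
  using assms
proof (induction xs arbitrary: ys rule: rev_induct)
  case Nil
  have r: "convex hull r = r" "r \<noteq> {}" if "r \<in> C" for r
    using polytopal_complexD[OF C that] by (simp_all add: hull_same)
  have "partial_derived C p {} = {convex hull r | r. r \<in> C \<and> r \<noteq> {}}"
    by (auto simp: partial_derived_def chain_subset_def)
  also have "\<dots> = {r. r \<in> C}"
    using r by (intro Collect_cong) (metis (no_types))
  finally show ?case by simp
next
  case (snoc s xs)
  have "fold (\<lambda>s K. stellar K s (p s)) xs C = partial_derived C p (set xs)"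
    using snoc.prems by (intro snoc.IH[of "s # ys"]) auto
  moreover have "stellar (partial_derived C p (set xs)) s (p s) = partial_derived C p (insert s (set xs))"
    using snoc.prems by (intro stellar_partial_derived) (auto simp: sorted_wrt_append)
  ultimately show ?case by simp
qed

text \<open>Sending a chain to the hull of its apexes is an order embedding, because an apex lies in
  such a hull only if its cell is in the chain.\<close>

lemma collapsible_derived:
  assumes "collapsible (order_complex C)"
  shows "collapsible (partial_derived C p C)"
proof -
  define g where "g c = convex hull (p ` c)" for c
  have sub: "g s \<subseteq> g t \<longleftrightarrow> s \<subseteq> t" if s: "s \<in> order_complex C" and t: "t \<in> order_complex C" for s t
  proof
    show "g s \<subseteq> g t" if "s \<subseteq> t" unfolding g_def using that by (intro hull_mono) blast
    show "s \<subseteq> t" if "g s \<subseteq> g t"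
    proof
      fix q assume "q \<in> s"
      have qC: "q \<in> C" using s \<open>q \<in> s\<close> by (auto simp: order_complex_def)
      have "p q \<in> convex hull (p ` s)" using \<open>q \<in> s\<close> by (simp add: hull_inc)
      then have "p q \<in> convex hull ({} \<union> p ` t)" using that by (auto simp: g_def)
      moreover have "t \<subseteq> C" "chain_subset t" using t by (auto simp: order_complex_def)
      moreover have "{} \<subset> r" if "r \<in> t" for r
        using polytopal_complexD(2)[OF C] \<open>t \<subseteq> C\<close> that by blast
      ultimately have "q \<subseteq> {} \<or> q \<in> t" using qC by (intro apex_in_hull_cases) auto
      then show "q \<in> t" using polytopal_complexD(2)[OF C qC] by blast
    qed
  qed
  obtain v where "elementary_collapse\<^sup>*\<^sup>* (order_complex C) {{v}}"
    using assms unfolding collapsible_def by blast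
  then have "elementary_collapse\<^sup>*\<^sup>* (g ` order_complex C) (g ` {{v}})"
  proof (rule collapses_image)
    show "inj_on g (order_complex C)" using sub by (metis inj_onI set_eq_subset)
    show "g s \<subset> g t \<longleftrightarrow> s \<subset> t" if "s \<in> order_complex C" "t \<in> order_complex C" for s t
      using sub that by (metis less_le_not_le)
    show "g s \<noteq> {}" if "s \<in> order_complex C" for s
      using that by (simp add: g_def order_complex_def)
  qed
  moreover have "partial_derived C p C = g ` order_complex C"
  proof
    show "partial_derived C p C \<subseteq> g ` order_complex C"
      by (auto simp: partial_derived_def g_def order_complex_def)
    show "g ` order_complex C \<subseteq> partial_derived C p C"
    proof
      fix t assume "t \<in> g ` order_complex C"
      then obtain c where c: "c \<subseteq> C" "c \<noteq> {}" "chain_subset c" "t = convex hull ({} \<union> p ` c)"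
        by (auto simp: g_def order_complex_def)
      have "\<forall>q\<in>c. {} \<subset> q" using c(1) polytopal_complexD(2)[OF C] by blast
      then show "t \<in> partial_derived C p C"
        unfolding c(4) using c by (intro partial_derivedI) auto
    qed
  qed
  ultimately show ?thesis unfolding collapsible_def by (auto simp: g_def)
qed

end

theorem theorem2p3:
  fixes C :: "'a::euclidean_space set set" and P :: "'a set" and d :: nat
  assumes "polytope P" and "aff_dim P = int d"
    and "subdivision_of C P"
  shows "\<forall>D. derived_subdivision C D \<longrightarrow> collapsible D"
proof (intro allI impI)
  fix D assume "derived_subdivision C D"
  then obtain fs p where fs: "distinct fs" "set fs = C" "sorted_wrt (\<lambda>s t. aff_dim s \<ge> aff_dim t) fs"
    and "\<forall>s\<in>C. p s \<in> rel_interior s" and D: "D = fold (\<lambda>s K. stellar K s (p s)) fs C"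
    unfolding derived_subdivision_def by blast
  then have p: "\<And>s. s \<in> C \<Longrightarrow> p s \<in> rel_interior s" by blast
  have C: "polytopal_complex C" and P: "\<Union>C = P"
    using assms(3) by (simp_all add: subdivision_of_def)
  have "P \<noteq> {}" using assms(2) by auto
  then have "C \<noteq> {}" using P by auto
  then have "collapsible (order_complex C)"
    using C P assms(1) polytope_imp_convex
    by (intro collapsible_order_complex_polyhedral polytopal_imp_polyhedral_complex) auto
  then have "collapsible (partial_derived C p C)"
    using collapsible_derived[OF C, of p] p by simp
  moreover have "sorted_wrt (\<lambda>s t. \<not> s \<subset> t) fs"
  proof (rule sorted_wrt_mono_rel[OF _ fs(3)])
    fix s t assume "s \<in> set fs" "t \<in> set fs" "aff_dim s \<ge> aff_dim t"
    then show "\<not> s \<subset> t"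
      using polytopal_complex_aff_dim_less[OF C, of s t] fs(2) by auto
  qed
  then have "D = partial_derived C p C"
    unfolding D using fold_stellar[OF C, of p fs "[]"] p fs(1,2) by simp
  ultimately show "collapsible D" by simp
qed

end
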